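(* Let $\mathcal{K}\subset[0,1]$ be the middle-third Cantor set, let $P:\mathbb{R}^2\to\mathbb{R}$ be defined by $P(x,y):=xy$, and let $\mathcal{L}$ denote the Lebesgue measure on $\mathbb{R}$. Then $$ \bigg|\mathcal{L}\big(P(\mathcal{K}\times\mathcal{K})\big)-\frac{91782451}{113374080}\bigg|\leq\frac{1}{10^6}. $$
   Context: The middle-third Cantor set $\mathcal{K}$ is the set of points of the form $x=\sum_{k=1}^\infty \alpha_k/3^k$ with $\alpha_k\in\{0,2\}$ for every $k\geq1$. $P(\mathcal{K}\times\mathcal{K})=\{xy: x,y\in\mathcal{K}\}$. *)

theory Defs
  imports "HOL-Analysis.Analysis"
begin

(* The digits are alpha 1, alpha 2, ...; the summation index is shifted because suminf starts
   at 0.  The series always converges, by comparison with a geometric series. *)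
definition cantor_set :: "real set" where
  "cantor_set = {(\<Sum>k. \<alpha> (Suc k) / 3 ^ Suc k) |\<alpha> :: nat \<Rightarrow> real. \<forall>k\<ge>1. \<alpha> k \<in> {0, 2}}"

definition mult_map :: "real \<times> real \<Rightarrow> real" where
  "mult_map = (\<lambda>(x, y). x * y)"

end

theory Submission
  imports Defs
begin

text \<open>Write \<open>A = K \<inter> [2/3, 1]\<close>. Since \<open>K = K/3 \<union> A\<close>, the products satisfy \<open>KK = KK/3 \<union> AA\<close>, a disjoint
  union, so \<open>KK\<close> has measure \<open>3/2\<close> times that of \<open>AA\<close>. A cylinder \<open>C\<close> of length \<open>3k\<close> with left endpoint \<open>a\<close>
  splits into two halves \<open>C\<^sub>0\<close>, \<open>C\<^sub>1\<close> of length \<open>k\<close>, and \<open>C\<^sub>0C\<^sub>1\<close> is a full interval, because off the diagonal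
  the level curves of \<open>xy\<close> are not parallel to the antidiagonal. This interval leaves a gap of
  length \<open>k\<^sup>2\<close> below \<open>C\<^sub>1C\<^sub>1\<close> and overlaps the convex hull of \<open>C\<^sub>0C\<^sub>0\<close> in a piece of length \<open>k\<^sup>2\<close>. Ignoring
  that the overlap covers some gaps of \<open>C\<^sub>0C\<^sub>0\<close> gives the value \<open>17/21\<close>. The correction is a rapidly
  convergent sum, because for \<open>k = 3\<^sup>-\<^sup>q\<close> the overlap lies over a cylinder of length \<open>k\<^sup>2 = 3\<^sup>-\<^sup>2\<^sup>q\<close>; two
  levels of it suffice for the stated precision.\<close>

section \<open>Self-similarity\<close>

lemma summable_ternary_digits:
  fixes d :: "nat \<Rightarrow> real"
  assumes "\<And>k. d k \<in> {0, 2}"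
  shows "summable (\<lambda>k. d k / 3 ^ Suc k)"
proof (rule summable_comparison_test')
  show "summable (\<lambda>k. 2 * (1 / 3 :: real) ^ k)"
    by (intro summable_mult summable_geometric) simp
  show "norm (d k / 3 ^ Suc k) \<le> 2 * (1 / 3 :: real) ^ k" for k
    using assms[of k] by (auto simp: field_simps)
qed

lemma cantor_setI:
  assumes "\<And>k. d k \<in> {0, 2}"
  shows "(\<Sum>k. d k / 3 ^ Suc k) \<in> cantor_set"
  unfolding cantor_set_def
  \<comment> \<open>The digits of \<open>cantor_set\<close> start at index \<open>1\<close>, those
    of \<open>d\<close> at \<open>0\<close>.\<close>
  by (intro CollectI exI[of _ "\<lambda>k. d (k - 1)"] conjI allI impI assms) simp

lemma cantor_setE:
  assumes "x \<in> cantor_set"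
  obtains d where "\<And>k. d k \<in> {0, 2}" "x = (\<Sum>k. d k / 3 ^ Suc k)"
proof -
  obtain \<alpha> where "\<forall>k\<ge>1. \<alpha> k \<in> {0, 2}" "x = (\<Sum>k. \<alpha> (Suc k) / 3 ^ Suc k)"
    using assms unfolding cantor_set_def by blast
  then show ?thesis
    by (intro that[of "\<lambda>k. \<alpha> (Suc k)"]) simp_all
qed

lemma cantor_set_split:
  assumes "x \<in> cantor_set"
  shows "\<exists>y\<in>cantor_set. x = y / 3 \<or> x = 2 / 3 + y / 3"
proof -
  obtain d where d: "\<And>k. d k \<in> {0, 2}" and x: "x = (\<Sum>k. d k / 3 ^ Suc k)"
    using assms by (blast elim: cantor_setE)
  define y where "y = (\<Sum>k. d (Suc k) / 3 ^ Suc k)"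
  have "x = d 0 / 3 + (\<Sum>k. d (Suc k) / 3 ^ Suc (Suc k))"
    using suminf_split_head[OF summable_ternary_digits, of d] d x by simp
  also have "(\<Sum>k. d (Suc k) / 3 ^ Suc (Suc k)) = (\<Sum>k. (1 / 3) * (d (Suc k) / 3 ^ Suc k))"
    by simp
  also have "\<dots> = y / 3"
    unfolding y_def by (subst suminf_mult) (use summable_ternary_digits[of "\<lambda>k. d (Suc k)"] d in auto)
  finally have "x = d 0 / 3 + y / 3" .
  moreover have "y \<in> cantor_set"
    unfolding y_def using d by (intro cantor_setI)
  ultimately show ?thesis
    using d[of 0] by auto
qed

lemma cantor_set_subset_Icc: "cantor_set \<subseteq> {0..1}"
proof
  fix x assume "x \<in> cantor_set"
  then obtain d where d: "\<And>k. d k \<in> {0, 2}" and x: "x = (\<Sum>k. d k / 3 ^ Suc k)"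
    by (blast elim: cantor_setE)
  have sum: "(\<lambda>k. (2 / 3) * (1 / 3 :: real) ^ k) sums ((2 / 3) * (1 / (1 - 1 / 3)))"
    by (intro sums_mult geometric_sums) simp
  have "0 \<le> x"
    unfolding x
  proof (intro suminf_nonneg summable_ternary_digits d)
    show "0 \<le> d k / 3 ^ Suc k" for k
      using d[of k] by auto
  qed
  moreover have "x \<le> (\<Sum>k. (2 / 3) * (1 / 3 :: real) ^ k)"
    unfolding x
  proof (intro suminf_le summable_ternary_digits d sums_summable[OF sum])
    show "d k / 3 ^ Suc k \<le> (2 / 3) * (1 / 3) ^ k" for k
      using d[of k] by (auto simp: field_simps)
  qed
  ultimately show "x \<in> {0..1}"
    using sums_unique[OF sum] by simp
qed

text \<open>Iterating the choice of \<open>y\<close> reads off ternary digits; the remainder after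
  \<open>n\<close> digits is at most \<open>1 / 3 ^ n\<close>. Membership in the Cantor set can thus
  be shown without handling series.\<close>

lemma cantor_set_coinduct:
  assumes F: "F \<subseteq> {0..1}" and split: "\<And>x. x \<in> F \<Longrightarrow> \<exists>y\<in>F. x = y / 3 \<or> x = 2 / 3 + y / 3"
  shows "F \<subseteq> cantor_set"
proof
  fix x assume x: "x \<in> F"
  have "\<exists>y e. y \<in> F \<and> e \<in> {0, 2 :: real} \<and> u = e / 3 + y / 3" if u: "u \<in> F" for u
  proof -
    obtain y where "y \<in> F" "u = 0 / 3 + y / 3 \<or> u = 2 / 3 + y / 3"
      using split[OF u] by auto
    then show ?thesis by blast
  qed
  then obtain f e where fe: "\<And>u. u \<in> F \<Longrightarrow> f u \<in> F \<and> e u \<in> {0, 2 :: real} \<and> u = e u / 3 + f u / 3"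
    by metis
  define d where "d k = e ((f ^^ k) x)" for k
  have orbit: "(f ^^ k) x \<in> F" for k
    by (induction k) (use x fe in auto)
  have d: "d k \<in> {0, 2}" for k
    using fe orbit unfolding d_def by blast
  have partial: "x = (\<Sum>k<n. d k / 3 ^ Suc k) + (f ^^ n) x / 3 ^ n" for n
  proof (induction n)
    case (Suc n)
    have "(f ^^ n) x = d n / 3 + (f ^^ Suc n) x / 3"
      unfolding d_def funpow.simps o_apply using fe[OF orbit[of n]] by blast
    then have "(f ^^ n) x / 3 ^ n = (d n / 3 + (f ^^ Suc n) x / 3) / 3 ^ n"
      by (rule arg_cong)
    also have "\<dots> = d n / 3 ^ Suc n + (f ^^ Suc n) x / 3 ^ Suc n"
      by (simp add: add_divide_distrib)
    finally show ?case
      unfolding sum.lessThan_Suc using Suc.IH by linarith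
  qed simp
  have "(\<lambda>n. (f ^^ n) x / 3 ^ n) \<longlonglongrightarrow> 0"
  proof (rule Lim_null_comparison)
    show "\<forall>\<^sub>F n in sequentially. norm ((f ^^ n) x / 3 ^ n) \<le> (1 / 3) ^ n"
    proof (intro always_eventually allI)
      fix n
      have "(f ^^ n) x \<in> {0..1}" using orbit F by blast
      then show "norm ((f ^^ n) x / 3 ^ n) \<le> (1 / 3) ^ n"
        by (simp add: power_one_over divide_right_mono)
    qed
    show "(\<lambda>n. (1 / 3 :: real) ^ n) \<longlonglongrightarrow> 0"
      by (intro LIMSEQ_realpow_zero) auto
  qed
  then have "(\<lambda>n. x - (f ^^ n) x / 3 ^ n) \<longlonglongrightarrow> x - 0"
    by (intro tendsto_intros)
  moreover have "x - (f ^^ n) x / 3 ^ n = (\<Sum>k<n. d k / 3 ^ Suc k)" for n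
    using partial[of n] by linarith
  ultimately have "(\<lambda>k. d k / 3 ^ Suc k) sums x"
    by (simp add: sums_def)
  then show "x \<in> cantor_set"
    using cantor_setI[of d, OF d] sums_unique by metis
qed

text \<open>Coinduction on the Cantor set enlarged by its two images: points of the images split
  back into it by construction.\<close>

lemma cantor_set_join:
  assumes "y \<in> cantor_set"
  shows "y / 3 \<in> cantor_set" "2 / 3 + y / 3 \<in> cantor_set"
proof -
  let ?F = "cantor_set \<union> (\<lambda>y. y / 3) ` cantor_set \<union> (\<lambda>y. 2 / 3 + y / 3) ` cantor_set"
  have "?F \<subseteq> cantor_set"
  proof (rule cantor_set_coinduct)
    show "?F \<subseteq> {0..1}" using cantor_set_subset_Icc by force
    show "\<exists>y\<in>?F. x = y / 3 \<or> x = 2 / 3 + y / 3" if "x \<in> ?F" for x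
      using that cantor_set_split[of x] by blast
  qed
  with assms show "y / 3 \<in> cantor_set" "2 / 3 + y / 3 \<in> cantor_set" by auto
qed

lemma zero_in_cantor_set: "0 \<in> cantor_set"
  using cantor_setI[of "\<lambda>_. 0"] by simp

text \<open>The closure inherits the splitting property, since the union of its two images is closed
  and contains the Cantor set; by coinduction it adds no points.\<close>

lemma compact_cantor_set: "compact cantor_set"
proof -
  let ?C = "closure cantor_set" and ?l = "\<lambda>y :: real. y / 3" and ?r = "\<lambda>y :: real. 2 / 3 + y / 3"
  have cl: "?C \<subseteq> {0..1}"
    by (intro closure_minimal cantor_set_subset_Icc closed_atLeastAtMost)
  have C: "compact ?C"
    unfolding compact_closure
    by (rule bounded_subset[OF bounded_closed_interval cantor_set_subset_Icc])
  have l: "continuous_on ?C ?l"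
    by (rule continuous_on_divide[OF continuous_on_id continuous_on_const]) simp
  moreover have "continuous_on ?C ?r"
    by (rule continuous_on_add[OF continuous_on_const l])
  ultimately have "compact (?l ` ?C)" "compact (?r ` ?C)"
    using C by (auto intro: compact_continuous_image)
  then have "closed (?l ` ?C \<union> ?r ` ?C)"
    by (simp add: closed_Un compact_imp_closed)
  moreover have "cantor_set \<subseteq> ?l ` ?C \<union> ?r ` ?C"
  proof
    fix x assume "x \<in> cantor_set"
    then obtain y where "y \<in> cantor_set" "x = ?l y \<or> x = ?r y"
      using cantor_set_split by blast
    then show "x \<in> ?l ` ?C \<union> ?r ` ?C"
      using closure_subset[of cantor_set] by blast
  qed
  ultimately have "?C \<subseteq> ?l ` ?C \<union> ?r ` ?C"
    by (rule closure_minimal[rotated])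
  then have "?C \<subseteq> cantor_set"
    by (intro cantor_set_coinduct[OF cl]) blast
  then have "?C = cantor_set"
    using closure_subset by (rule equalityI)
  with C show ?thesis by metis
qed

section \<open>Cylinders of the Cantor set\<close>

definition cyl :: "real \<Rightarrow> real \<Rightarrow> real set" where
  "cyl a h = (\<lambda>t. a + h * t) ` cantor_set"

lemma cyl_split: "cyl a (3 * k) = cyl a k \<union> cyl (a + 2 * k) k"
proof
  show "cyl a (3 * k) \<subseteq> cyl a k \<union> cyl (a + 2 * k) k"
  proof
    fix x assume "x \<in> cyl a (3 * k)"
    then obtain t where t: "t \<in> cantor_set" "x = a + 3 * k * t" by (auto simp: cyl_def)
    obtain y where "y \<in> cantor_set" "t = y / 3 \<or> t = 2 / 3 + y / 3"
      using cantor_set_split[OF t(1)] by blast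
    then have "y \<in> cantor_set" "x = a + k * y \<or> x = a + 2 * k + k * y"
      using t(2) by (auto simp: algebra_simps)
    then show "x \<in> cyl a k \<union> cyl (a + 2 * k) k" by (auto simp: cyl_def)
  qed
  show "cyl a k \<union> cyl (a + 2 * k) k \<subseteq> cyl a (3 * k)"
  proof
    fix x assume "x \<in> cyl a k \<union> cyl (a + 2 * k) k"
    then obtain y where y: "y \<in> cantor_set" "x = a + k * y \<or> x = a + 2 * k + k * y"
      unfolding cyl_def by blast
    then have "x = a + 3 * k * (y / 3) \<or> x = a + 3 * k * (2 / 3 + y / 3)"
      by (simp add: algebra_simps)
    then show "x \<in> cyl a (3 * k)"
      unfolding cyl_def using cantor_set_join[OF y(1)] by blast
  qed
qed

lemma cyl_subset_Icc: "0 \<le> h \<Longrightarrow> cyl a h \<subseteq> {a..a + h}"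
proof
  fix x assume h: "0 \<le> h" and "x \<in> cyl a h"
  then obtain t where "t \<in> {0..1}" "x = a + h * t"
    using cantor_set_subset_Icc unfolding cyl_def by blast
  then show "x \<in> {a..a + h}"
    using h mult_left_le[of t h] by simp
qed

lemma left_endpoint_in_cyl: "a \<in> cyl a h"
  unfolding cyl_def by (rule image_eqI[OF _ zero_in_cantor_set]) simp

lemma compact_cyl: "compact (cyl a h)"
  unfolding cyl_def by (intro compact_continuous_image continuous_intros compact_cantor_set)

section \<open>Products of cylinders\<close>

definition prod_set :: "real set \<Rightarrow> real set \<Rightarrow> real set" where
  "prod_set A B = {x * y |x y. x \<in> A \<and> y \<in> B}"

lemma prod_set_eq_image: "prod_set A B = (\<lambda>z. fst z * snd z) ` (A \<times> B)"
  unfolding prod_set_def by force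

lemma compact_prod_set: "compact A \<Longrightarrow> compact B \<Longrightarrow> compact (prod_set A B)"
  unfolding prod_set_eq_image
  by (rule compact_continuous_image[OF _ compact_Times]) (intro continuous_intros)

lemma prod_set_commute: "prod_set A B = prod_set B A"
proof -
  have "(\<exists>x y. z = x * y \<and> x \<in> A \<and> y \<in> B) \<longleftrightarrow> (\<exists>y x. z = y * x \<and> y \<in> B \<and> x \<in> A)" for z
    by (subst mult.commute) blast
  then show ?thesis
    unfolding prod_set_def by (rule Collect_cong)
qed

lemma prod_set_Un_right: "prod_set A (B \<union> C) = prod_set A B \<union> prod_set A C"
  unfolding prod_set_def by blast

text \<open>With \<open>A\<close> the lower and \<open>B\<close> the upper third of the Cantor set,
  this gives the decomposition behind \<open>measure_products\<close>; mixed products go to the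
  first part.\<close>

lemma prod_set_Un_self: "prod_set (A \<union> B) (A \<union> B) = prod_set A (A \<union> B) \<union> prod_set B B"
proof -
  have "prod_set (A \<union> B) (A \<union> B) = prod_set A (A \<union> B) \<union> prod_set B (A \<union> B)"
    unfolding prod_set_def by blast
  then show ?thesis
    unfolding prod_set_Un_right prod_set_commute[of B A] by blast
qed

lemma prod_set_scale: "prod_set ((*) c ` A) B = (*) c ` prod_set A B"
proof -
  have "(\<lambda>z. fst z * snd z) ` ((*) c ` A \<times> B) = (\<lambda>z. c * fst z * snd z) ` (A \<times> B)"
    by force
  then show ?thesis
    unfolding prod_set_eq_image image_image mult.assoc .
qed

lemma prod_set_subset_Icc:
  assumes "A \<subseteq> {a..a'}" "B \<subseteq> {b..b'}" "0 \<le> a" "0 \<le> b"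
  shows "prod_set A B \<subseteq> {a * b..a' * b'}"
proof
  fix z assume "z \<in> prod_set A B"
  then obtain x y where "x \<in> A" "y \<in> B" "z = x * y" by (auto simp: prod_set_def)
  moreover from this have "a \<le> x" "x \<le> a'" "b \<le> y" "y \<le> b'" using assms by auto
  ultimately show "z \<in> {a * b..a' * b'}"
    using assms(3,4) by (auto intro!: mult_mono)
qed

text \<open>The hypotheses \<open>x + h \<le> y\<close> and \<open>y + h \<le> 3 * x\<close> pass to the four subsquares, and make their
  images overlap consecutively.\<close>


lemma prod_cyl_approx:
  assumes "0 \<le> h" "x + h \<le> y" "y + h \<le> 3 * x" "y + h \<le> 1" "z \<in> {x * y..(x + h) * (y + h)}"
  shows "\<exists>p\<in>cyl x h. \<exists>q\<in>cyl y h. \<bar>p * q - z\<bar> \<le> 2 * h / 3 ^ n"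
  using assms
proof (induction n arbitrary: x y h)
  case 0
  have "(x + h) * (y + h) - x * y = h * (x + (y + h))" by (simp add: algebra_simps)
  also have "\<dots> \<le> h * 2" using 0 by (intro mult_left_mono) auto
  finally have "\<bar>x * y - z\<bar> \<le> 2 * h" using 0(5) by auto
  then show ?case using left_endpoint_in_cyl by auto
next
  case (Suc n)
  define t where "t = h / 3"
  have h: "h = 3 * t" and t: "0 \<le> t" using Suc.prems(1) by (auto simp: t_def)
  \<comment> \<open>Each inequality says that one of the four image intervals below, in the order
    listed, starts no later than its predecessor ends.\<close>
  have "t * x \<le> t * (y + t)" "t * y \<le> t * (3 * x + 3 * t)" "t * (x + t) \<le> t * y"
    using Suc.prems t h by (auto intro!: mult_left_mono)
  then have "z \<in> {x * y..(x + t) * (y + t)} \<or> z \<in> {x * (y + 2 * t)..(x + t) * (y + 2 * t + t)} \<or>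
      z \<in> {(x + 2 * t) * y..(x + 2 * t + t) * (y + t)} \<or>
      z \<in> {(x + 2 * t) * (y + 2 * t)..(x + 2 * t + t) * (y + 2 * t + t)}"
    using Suc.prems(5) unfolding h atLeastAtMost_iff by (simp add: algebra_simps) linarith
  then obtain x' y' where xy': "x' = x \<or> x' = x + 2 * t" "y' = y \<or> y' = y + 2 * t"
    and z: "z \<in> {x' * y'..(x' + t) * (y' + t)}"
    by blast
  have "\<exists>p\<in>cyl x' t. \<exists>q\<in>cyl y' t. \<bar>p * q - z\<bar> \<le> 2 * t / 3 ^ n"
    by (rule Suc.IH) (use xy' z t h Suc.prems in auto)
  moreover have "cyl x' t \<subseteq> cyl x h" "cyl y' t \<subseteq> cyl y h"
    using xy' unfolding h cyl_split by auto
  ultimately show ?case unfolding h by force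
qed

text \<open>\<open>prod_cyl_approx\<close> makes the products dense in the interval, and compactness
  makes them closed.\<close>

lemma prod_cyl_eq_Icc:
  assumes "0 \<le> x" "0 \<le> h" "x + h \<le> y" "y + h \<le> 3 * x" "y + h \<le> 1"
  shows "prod_set (cyl x h) (cyl y h) = {x * y..(x + h) * (y + h)}" (is "?P = ?I")
proof
  show "?P \<subseteq> ?I"
    using assms by (intro prod_set_subset_Icc cyl_subset_Icc) auto
  show "?I \<subseteq> ?P"
  proof
    fix z assume z: "z \<in> ?I"
    have "\<exists>w\<in>?P. \<bar>w - z\<bar> \<le> 2 * h / 3 ^ n" for n
      using prod_cyl_approx[OF assms(2-5) z, of n] by (auto simp: prod_set_def)
    then obtain w where w: "\<And>n. w n \<in> ?P" "\<And>n. \<bar>w n - z\<bar> \<le> 2 * h / 3 ^ n" by metis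
    have "(\<lambda>n. 2 * h * (1 / 3) ^ n) \<longlonglongrightarrow> 2 * h * 0"
      by (intro tendsto_intros LIMSEQ_realpow_zero) auto
    then have "(\<lambda>n. w n - z) \<longlonglongrightarrow> 0"
      by (intro Lim_null_comparison[of "\<lambda>n. w n - z" "\<lambda>n. 2 * h * (1 / 3) ^ n"])
        (use w(2) in \<open>auto simp: power_divide\<close>)
    then have "w \<longlonglongrightarrow> z" by (rule LIM_zero_cancel)
    moreover have "closed ?P" by (intro compact_imp_closed compact_prod_set compact_cyl)
    ultimately show "z \<in> ?P" using w(1) closed_sequentially by blast
  qed
qed

section \<open>The product of a cylinder with itself\<close>

definition sq :: "real \<Rightarrow> real \<Rightarrow> real set" where
  "sq a h = prod_set (cyl a h) (cyl a h)"

lemma sq_split: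
  assumes "2 / 3 \<le> a" "0 \<le> k" "a + 3 * k \<le> 1"
  shows "sq a (3 * k) = sq a k \<union> {a * (a + 2 * k)..(a + k) * (a + 3 * k)} \<union> sq (a + 2 * k) k"
proof -
  have "prod_set (cyl a k) (cyl (a + 2 * k) k) = {a * (a + 2 * k)..(a + k) * (a + 2 * k + k)}"
    using assms by (intro prod_cyl_eq_Icc) auto
  moreover have "prod_set (A \<union> B) (A \<union> B) = prod_set A A \<union> prod_set A B \<union> prod_set B B" for A B
    by (simp only: prod_set_Un_self[of A B] prod_set_Un_right[of A A B])
  ultimately show ?thesis
    unfolding sq_def cyl_split by (simp add: add.assoc)
qed

lemma sq_subset_Icc: "0 \<le> a \<Longrightarrow> 0 \<le> h \<Longrightarrow> sq a h \<subseteq> {a\<^sup>2..(a + h)\<^sup>2}"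
  unfolding sq_def power2_eq_square by (intro prod_set_subset_Icc cyl_subset_Icc)

lemma lmeasurable_sq: "sq a h \<in> lmeasurable"
  unfolding sq_def by (intro lmeasurable_compact compact_prod_set compact_cyl)

text \<open>Only the last part of the splitting reaches above \<open>(a + 2 * k)\<^sup>2\<close>.\<close>

lemma sq_top:
  assumes "2 / 3 \<le> a" "0 < m" "a + 3 ^ j * m \<le> 1"
  shows "sq a (3 ^ j * m) \<inter> {(a + 3 ^ j * m - m)\<^sup>2..} = sq (a + 3 ^ j * m - m) m"
  using assms
proof (induction j arbitrary: a)
  case 0
  then show ?case using sq_subset_Icc[of a m] by auto
next
  case (Suc j)
  define k where "k = 3 ^ j * m"
  have k: "0 < k" "m \<le> k" "3 ^ Suc j * m = 3 * k"
    using Suc.prems by (auto simp: k_def)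
  have a: "a + 3 * k \<le> 1" "0 \<le> a"
    using Suc.prems k by auto
  let ?J = "{(a + 3 * k - m)\<^sup>2..}"
  have "(a + 2 * k)\<^sup>2 \<le> (a + 3 * k - m)\<^sup>2"
    using k a by (intro power_mono) auto
  moreover have "(a + k)\<^sup>2 < (a + 2 * k)\<^sup>2"
    using k a by (intro power_strict_mono) auto
  \<comment> \<open>The two sides differ by \<open>k^2\<close>, the gap above the middle
    interval.\<close>
  moreover have "(a + k) * (a + 3 * k) < (a + 2 * k)\<^sup>2"
    using k(1) by (simp add: power2_eq_square algebra_simps)
  moreover have "sq a k \<subseteq> {a\<^sup>2..(a + k)\<^sup>2}"
    using sq_subset_Icc[of a k] k a by simp
  ultimately have "sq a k \<inter> ?J = {}" "{a * (a + 2 * k)..(a + k) * (a + 3 * k)} \<inter> ?J = {}"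
    by (force, force)
  then have "sq a (3 * k) \<inter> ?J = sq (a + 2 * k) k \<inter> ?J"
    using sq_split[of a k] Suc.prems k a by auto
  also have "\<dots> = sq (a + 3 * k - m) m"
    using Suc.IH[of "a + 2 * k", folded k_def] Suc.prems(1,2) k(1) a(1) by (simp add: add.assoc)
  finally show ?case
    unfolding k(3) .
qed

section \<open>The measure of the gaps\<close>

definition defect :: "real \<Rightarrow> real \<Rightarrow> real" where
  "defect a h = measure lebesgue ({a\<^sup>2..(a + h)\<^sup>2} - sq a h)"

text \<open>When \<open>a\<close>, \<open>h\<close> belong to the lower third of a cylinder, the part of \<open>{a\<^sup>2..(a + h)\<^sup>2}\<close> that is
  also covered by the middle interval of \<open>sq_split\<close> is its top piece of length \<open>h\<^sup>2\<close>.\<close>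

definition top_defect :: "real \<Rightarrow> real \<Rightarrow> real" where
  "top_defect a h = measure lebesgue ({(a + h)\<^sup>2 - h\<^sup>2..(a + h)\<^sup>2} - sq a h)"

lemma defect_nonneg: "0 \<le> defect a h"
  by (simp add: defect_def)

lemma top_defect_nonneg: "0 \<le> top_defect a h"
  by (simp add: top_defect_def)

lemma lmeasurable_Icc_Diff_sq: "{u..v} - sq a h \<in> lmeasurable"
  by (intro fmeasurable.Diff lmeasurable_sq lmeasurable_compact compact_Icc)

lemma measure_fmeasurable_Un_disjoint:
  assumes "A \<in> fmeasurable M" "B \<in> fmeasurable M" "A \<inter> B = {}"
  shows "measure M (A \<union> B) = measure M A + measure M B"
  using assms by (simp add: measure_Un3)

text \<open>The middle interval \<open>{p1..p3}\<close> fills the gaps of the lower half in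
  \<open>{p1..p2}\<close>, whose measure is \<open>top_defect a k\<close>. What remains uncovered
  are the other gaps of the lower half, the gap between \<open>p3\<close> and \<open>p4\<close> of
  length \<open>k^2\<close>, and the gaps of the upper half.\<close>

lemma defect_split:
  assumes "2 / 3 \<le> a" "0 < k" "a + 3 * k \<le> 1"
  shows "defect a (3 * k) + top_defect a k = defect a k + defect (a + 2 * k) k + k\<^sup>2"
proof -
  define p0 p1 p2 p3 p4 p5 where p:
    "p0 = a\<^sup>2" "p1 = a * (a + 2 * k)" "p2 = (a + k)\<^sup>2" "p3 = (a + k) * (a + 3 * k)"
    "p4 = (a + 2 * k)\<^sup>2" "p5 = (a + 3 * k)\<^sup>2"
  have le: "p0 \<le> p1" "p1 \<le> p2" "p2 \<le> p3" "p3 < p4" "p4 \<le> p5"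
    using assms by (auto simp: p power2_eq_square algebra_simps)
  have p1: "p2 - k\<^sup>2 = p1" and p34: "p4 - p3 = k\<^sup>2"
    by (simp_all add: p power2_eq_square algebra_simps)
  have V0: "sq a k \<subseteq> {p0..p2}" and V1: "sq (a + 2 * k) k \<subseteq> {p4..p5}"
    using sq_subset_Icc[of a k] sq_subset_Icc[of "a + 2 * k" k] assms by (auto simp: p add.assoc)
  define L T R where LTR: "L = {p0..p2} - sq a k" "T = {p1..p2} - sq a k"
    "R = {p4..p5} - sq (a + 2 * k) k"
  note m = lmeasurable_Icc_Diff_sq
  have lm: "L \<in> lmeasurable" "T \<in> lmeasurable" "R \<in> lmeasurable"
    unfolding LTR by (rule m)+
  have TL: "T \<subseteq> L" using le by (auto simp: LTR)
  have eq: "{p0..p5} - sq a (3 * k) = (L - T) \<union> ({p3<..<p4} \<union> R)"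
    using le V0 V1 unfolding sq_split[of a k, OF assms(1) less_imp_le[OF assms(2)] assms(3), folded p] LTR
    by auto
  have "measure lebesgue ({p0..p5} - sq a (3 * k)) = measure lebesgue (L - T) + measure lebesgue ({p3<..<p4} \<union> R)"
    unfolding eq
  proof (rule measure_fmeasurable_Un_disjoint)
    show "(L - T) \<inter> ({p3<..<p4} \<union> R) = {}"
      using le by (auto simp: LTR)
  qed (use lm in auto)
  also have "measure lebesgue ({p3<..<p4} \<union> R) = measure lebesgue {p3<..<p4} + measure lebesgue R"
  proof (rule measure_fmeasurable_Un_disjoint)
    show "{p3<..<p4} \<inter> R = {}"
      by (auto simp: LTR)
  qed (use lm in auto)
  also have "measure lebesgue {p3<..<p4} = k\<^sup>2"
    using le p34 by simp
  also have "measure lebesgue (L - T) = measure lebesgue L - measure lebesgue T"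
    using TL lm by (simp add: measurable_measure_Diff fmeasurableD)
  finally have "measure lebesgue ({p0..p5} - sq a (3 * k)) =
      measure lebesgue L - measure lebesgue T + (k\<^sup>2 + measure lebesgue R)" .
  moreover have "defect a (3 * k) = measure lebesgue ({p0..p5} - sq a (3 * k))"
    by (simp add: defect_def p)
  moreover have "defect a k = measure lebesgue L" "defect (a + 2 * k) k = measure lebesgue R"
    by (simp_all add: defect_def LTR p add.assoc)
  moreover have "top_defect a k = measure lebesgue T"
    unfolding top_defect_def LTR p1[symmetric] by (simp add: p)
  ultimately show ?thesis by linarith
qed

text \<open>Dropping \<open>top_defect\<close> in \<open>defect_split\<close> leaves a recursion
  whose solution \<open>c * h^2\<close> satisfies \<open>9 * c = 2 * c + 1\<close>, so
  \<open>c = 1 / 7\<close>.\<close>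

lemma defect_le:
  assumes "2 / 3 \<le> a" "0 < h" "a + h \<le> 1"
  shows "defect a h \<le> h\<^sup>2 / 7"
proof -
  \<comment> \<open>The error starts from the trivial bound \<open>2 * h\<close>; each splitting
    gives two cylinders of a third of the length, hence the factor \<open>2 / 3\<close>.\<close>
  have approx: "defect a h \<le> h\<^sup>2 / 7 + 2 * h * (2 / 3) ^ n" for n
    using assms
  proof (induction n arbitrary: a h)
    case 0
    have "defect a h \<le> measure lebesgue {a\<^sup>2..(a + h)\<^sup>2}"
      unfolding defect_def
      by (intro measure_mono_fmeasurable fmeasurableD lmeasurable_Icc_Diff_sq lmeasurable_compact compact_Icc) auto
    also have "\<dots> = h * (a + (a + h))"
      using 0 by (simp add: power2_eq_square algebra_simps)
    also have "\<dots> \<le> h * 2"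
      using 0 by (intro mult_left_mono) auto
    finally show ?case
      by (simp add: add_increasing)
  next
    case (Suc n)
    define k where "k = h / 3"
    have k: "h = 3 * k" "0 < k" "a + 3 * k \<le> 1"
      using Suc.prems by (auto simp: k_def)
    have "defect a h \<le> defect a k + defect (a + 2 * k) k + k\<^sup>2"
      using defect_split[of a k] Suc.prems k top_defect_nonneg[of a k] by simp
    also have "\<dots> \<le> 2 * (k\<^sup>2 / 7 + 2 * k * (2 / 3) ^ n) + k\<^sup>2"
      using Suc.IH[of a k] Suc.IH[of "a + 2 * k" k] Suc.prems(1) k by simp
    also have "\<dots> = h\<^sup>2 / 7 + 2 * h * (2 / 3) ^ Suc n"
      by (simp add: k(1) power2_eq_square)
    finally show ?case .
  qed
  have "(\<lambda>n. h\<^sup>2 / 7 + 2 * h * (2 / 3) ^ n) \<longlonglongrightarrow> h\<^sup>2 / 7 + 2 * h * 0"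
    by (intro tendsto_intros LIMSEQ_realpow_zero) auto
  then show ?thesis
    using approx by (intro LIMSEQ_le_const[of _ "h\<^sup>2 / 7"]) auto
qed

text \<open>For \<open>h = 1 / 3 ^ q\<close> the top piece of length \<open>h\<^sup>2\<close> lies over a cylinder of length exactly
  \<open>h\<^sup>2\<close>; this is what makes \<open>top_defect\<close> comparable to the defect of a smaller cylinder.\<close>

lemma sq_top_cylinder:
  assumes "2 / 3 \<le> a" "a + h \<le> 1" "h = 1 / 3 ^ q"
  shows "sq a h \<inter> {(a + h - h\<^sup>2)\<^sup>2..} = sq (a + h - h\<^sup>2) (h\<^sup>2)"
proof -
  have "h = 3 ^ q * h\<^sup>2" "0 < h"
    using assms(3) by (simp_all add: power2_eq_square)
  then show ?thesis
    using sq_top[of a "h\<^sup>2" q] assms by simp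
qed

text \<open>The top piece lies within the hull of the square of the topmost subcylinder of length
  \<open>h^2\<close>, so \<open>defect_le\<close> for that subcylinder bounds it.\<close>

lemma top_defect_le:
  assumes "2 / 3 \<le> a" "a + h \<le> 1" "h = 1 / 3 ^ q"
  shows "top_defect a h \<le> h ^ 4 / 7"
proof -
  define b where "b = a + h - h\<^sup>2"
  have h: "0 < h" "h \<le> 1 / 3"
    by (simp add: assms(3), use assms(1,2) in linarith)
  then have hh: "0 < h\<^sup>2" "h\<^sup>2 \<le> h * (1 / 3)"
    unfolding power2_eq_square by (auto intro!: mult_left_mono)
  have b1: "2 / 3 \<le> b"
    unfolding b_def using assms(1) h(1,2) hh(2) by linarith
  have b2: "b + h\<^sup>2 = a + h"
    by (simp add: b_def)
  note b = b1 b2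
  \<comment> \<open>The hull has length \<open>h^2 * (2 * b + h^2)\<close>, and the second factor is
    at least \<open>1\<close>.\<close>
  have "h\<^sup>2 * 1 \<le> h\<^sup>2 * (2 * b + h\<^sup>2)"
    by (rule mult_left_mono) (use b1 hh(1) in linarith)+
  then have "b\<^sup>2 \<le> (a + h)\<^sup>2 - h\<^sup>2"
    unfolding b(2)[symmetric] by (simp add: power2_eq_square algebra_simps)
  then have "{(a + h)\<^sup>2 - h\<^sup>2..(a + h)\<^sup>2} - sq a h \<subseteq> {b\<^sup>2..(a + h)\<^sup>2} - sq a h \<inter> {b\<^sup>2..}"
    by auto
  also have "\<dots> = {b\<^sup>2..(b + h\<^sup>2)\<^sup>2} - sq b (h\<^sup>2)"
    unfolding b2 using sq_top_cylinder[OF assms] by (simp only: b_def)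
  finally have "{(a + h)\<^sup>2 - h\<^sup>2..(a + h)\<^sup>2} - sq a h \<subseteq> {b\<^sup>2..(b + h\<^sup>2)\<^sup>2} - sq b (h\<^sup>2)" .
  then have "top_defect a h \<le> defect b (h\<^sup>2)"
    unfolding top_defect_def defect_def
    by (intro measure_mono_fmeasurable fmeasurableD lmeasurable_Icc_Diff_sq)
  also have "\<dots> \<le> (h\<^sup>2)\<^sup>2 / 7"
    using b hh(1) assms(2) by (intro defect_le) linarith+
  finally show ?thesis by simp
qed

text \<open>Splitting the topmost subcylinder of length \<open>h^2\<close> once more shows the
  structure below \<open>e^2\<close>: a middle interval ending at \<open>e * (e - 2 * k)\<close>, a
  gap of length \<open>k^2\<close>, then the square of the upper half. Both sharper bounds on
  \<open>top_defect\<close> rest on this.\<close>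

lemma sq_near_top:
  fixes a h :: real
  assumes "2 / 3 \<le> a" "a + h \<le> 1" "h = 1 / 3 ^ q"
  defines "k \<equiv> h\<^sup>2 / 3"
  defines "e \<equiv> a + h"
  shows "0 < k" "3 * k = h\<^sup>2" "2 / 3 \<le> e - 3 * k" "e \<le> 1"
    and "e * (e - 2 * k) < (e - k)\<^sup>2" "(e - k)\<^sup>2 \<le> e\<^sup>2" "(e - k)\<^sup>2 - e * (e - 2 * k) = k\<^sup>2"
    and "sq a h \<inter> {(e - 3 * k)\<^sup>2..} =
      sq (e - 3 * k) k \<union> {(e - 3 * k) * (e - k)..e * (e - 2 * k)} \<union> sq (e - k) k"
    and "sq (e - 3 * k) k \<subseteq> {..(e - 2 * k)\<^sup>2}" "sq (e - k) k \<subseteq> {(e - k)\<^sup>2..}"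
proof -
  have h: "0 < h" "h \<le> 1 / 3"
    by (simp add: assms(3), use assms(1,2) in linarith)
  then have "h\<^sup>2 \<le> h * 1" "0 < h\<^sup>2"
    unfolding power2_eq_square by (auto intro!: mult_left_mono)
  then show k: "0 < k" "3 * k = h\<^sup>2" "2 / 3 \<le> e - 3 * k" "e \<le> 1"
    using assms h by auto
  show "(e - k)\<^sup>2 - e * (e - 2 * k) = k\<^sup>2"
    by (simp add: power2_eq_square algebra_simps)
  then show "e * (e - 2 * k) < (e - k)\<^sup>2"
    using k(1) by (simp add: algebra_simps)
  show "(e - k)\<^sup>2 \<le> e\<^sup>2"
    using k by (intro power_mono) auto
  have "sq a h \<inter> {(e - 3 * k)\<^sup>2..} = sq (e - 3 * k) (3 * k)"
    using sq_top_cylinder[OF assms(1-3)] k(2) by (simp add: e_def)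
  also have "\<dots> = sq (e - 3 * k) k \<union>
      {(e - 3 * k) * (e - 3 * k + 2 * k)..(e - 3 * k + k) * (e - 3 * k + 3 * k)} \<union> sq (e - 3 * k + 2 * k) k"
    using k(1,3,4) by (intro sq_split) auto
  also have "e - 3 * k + 2 * k = e - k"
    by simp
  also have "(e - 3 * k + k) * (e - 3 * k + 3 * k) = e * (e - 2 * k)"
    by (simp add: algebra_simps)
  finally show "sq a h \<inter> {(e - 3 * k)\<^sup>2..} =
      sq (e - 3 * k) k \<union> {(e - 3 * k) * (e - k)..e * (e - 2 * k)} \<union> sq (e - k) k" .
  show "sq (e - 3 * k) k \<subseteq> {..(e - 2 * k)\<^sup>2}" "sq (e - k) k \<subseteq> {(e - k)\<^sup>2..}"
    using sq_subset_Icc[of "e - 3 * k" k] sq_subset_Icc[of "e - k" k] k(1,3,4) by auto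
qed

lemma measure_Icc_gap_Un:
  assumes "u \<le> v"
  shows "{u<..<v} \<union> ({v..w} - sq a h) \<in> lmeasurable" (is "?A \<union> ?R \<in> _")
    and "measure lebesgue ({u<..<v} \<union> ({v..w} - sq a h)) = v - u + measure lebesgue ({v..w} - sq a h)"
proof -
  have "measure lebesgue (?A \<union> ?R) = measure lebesgue ?A + measure lebesgue ?R"
    by (rule measure_fmeasurable_Un_disjoint) (auto simp: lmeasurable_Icc_Diff_sq)
  then show "measure lebesgue (?A \<union> ?R) = v - u + measure lebesgue ?R"
    using assms by simp
  show "?A \<union> ?R \<in> lmeasurable"
    by (intro fmeasurable.Un lmeasurable_Icc_Diff_sq) simp
qed

text \<open>The top piece contains the whole gap of length \<open>k^2 = h^4 / 9\<close> and all gaps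
  of the square above it.\<close>

lemma top_defect_ge_defect:
  assumes "2 / 3 \<le> a" "a + h \<le> 1" "h = 1 / 3 ^ q"
  shows "h ^ 4 / 9 + defect (a + h - h\<^sup>2 / 3) (h\<^sup>2 / 3) \<le> top_defect a h"
proof -
  define k e where "k = h\<^sup>2 / 3" and "e = a + h"
  note * = sq_near_top[OF assms, folded k_def e_def]
  define R where "R = {(e - k)\<^sup>2..e\<^sup>2} - sq (e - k) k"
  \<comment> \<open>Since \<open>h^2 = 3 * k\<close>, this places the start of the top piece at or
    below the end of the middle interval.\<close>
  have "k * (2 * e) \<le> k * 3"
    using * by (intro mult_left_mono) auto
  then have low: "e\<^sup>2 - h\<^sup>2 \<le> e * (e - 2 * k)"
    unfolding *(2)[symmetric] by (simp add: power2_eq_square algebra_simps)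
  have up: "(e - 2 * k)\<^sup>2 \<le> e * (e - 2 * k)"
    unfolding power2_eq_square using * by (intro mult_right_mono) auto
  have "(e - 3 * k)\<^sup>2 \<le> (e - 2 * k)\<^sup>2"
    using * by (intro power_mono) auto
  have top: "z \<in> sq (e - k) k" if "z \<in> sq a h" "e * (e - 2 * k) < z" for z
  proof -
    have "(e - 2 * k)\<^sup>2 < z" "(e - 3 * k)\<^sup>2 < z"
      using up \<open>(e - 3 * k)\<^sup>2 \<le> (e - 2 * k)\<^sup>2\<close> that(2) by linarith+
    moreover from this have "z \<in> sq a h \<inter> {(e - 3 * k)\<^sup>2..}"
      using that by simp
    ultimately show ?thesis
      unfolding *(8) using *(9) that(2) by auto
  qed
  have "{e * (e - 2 * k)<..<(e - k)\<^sup>2} \<union> R \<subseteq> {e\<^sup>2 - h\<^sup>2..e\<^sup>2} - sq a h"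
  proof
    fix z assume z: "z \<in> {e * (e - 2 * k)<..<(e - k)\<^sup>2} \<union> R"
    then have "e * (e - 2 * k) < z" "z \<le> e\<^sup>2" "z \<notin> sq (e - k) k"
      using *(5,6,10) by (auto simp: R_def)
    then show "z \<in> {e\<^sup>2 - h\<^sup>2..e\<^sup>2} - sq a h"
      using top[of z] low by auto
  qed
  then have "measure lebesgue ({e * (e - 2 * k)<..<(e - k)\<^sup>2} \<union> R) \<le> top_defect a h"
    unfolding R_def top_defect_def e_def[symmetric] using *(5)
    by (intro measure_mono_fmeasurable fmeasurableD measure_Icc_gap_Un lmeasurable_Icc_Diff_sq) auto
  then have "k\<^sup>2 + measure lebesgue R \<le> top_defect a h"
    unfolding R_def using measure_Icc_gap_Un(2)[OF less_imp_le[OF *(5)]] *(7) by simp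
  then show ?thesis
    by (simp add: defect_def R_def k_def e_def power_divide)
qed

text \<open>The last hypothesis says exactly that the middle interval starts no later than the top
  piece. Then the gaps of \<open>top_defect_ge_defect\<close> are all there are, and
  \<open>k^2 + k^2 / 7\<close> with \<open>k = h^2 / 3\<close> is the bound.\<close>

lemma top_defect_le_sharp:
  assumes "2 / 3 \<le> a" "a + h \<le> 1" "h = 1 / 3 ^ q" "3 + h\<^sup>2 \<le> 4 * (a + h)"
  shows "top_defect a h \<le> 8 / 63 * h ^ 4"
proof -
  define k e where "k = h\<^sup>2 / 3" and "e = a + h"
  note * = sq_near_top[OF assms(1-3), folded k_def e_def]
  define R where "R = {(e - k)\<^sup>2..e\<^sup>2} - sq (e - k) k"
  have "k * (3 + 3 * k) \<le> k * (4 * e)"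
    using * assms(4) by (intro mult_left_mono) (auto simp: e_def)
  then have low: "(e - 3 * k) * (e - k) \<le> e\<^sup>2 - h\<^sup>2"
    unfolding *(2)[symmetric] by (simp add: power2_eq_square algebra_simps)
  have up: "(e - 3 * k)\<^sup>2 \<le> (e - 3 * k) * (e - k)"
    unfolding power2_eq_square using * by (intro mult_left_mono) auto
  have "{e\<^sup>2 - h\<^sup>2..e\<^sup>2} - sq a h \<subseteq> {e * (e - 2 * k)<..<(e - k)\<^sup>2} \<union> R"
  proof
    fix z assume z: "z \<in> {e\<^sup>2 - h\<^sup>2..e\<^sup>2} - sq a h"
    then have "(e - 3 * k) * (e - k) \<le> z" "(e - 3 * k)\<^sup>2 \<le> z"
      using low up by auto
    moreover from this have "z \<notin> sq a h \<inter> {(e - 3 * k)\<^sup>2..}"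
      using z by simp
    ultimately have "\<not> z \<le> e * (e - 2 * k)" "z \<notin> sq (e - k) k"
      unfolding *(8) by auto
    then show "z \<in> {e * (e - 2 * k)<..<(e - k)\<^sup>2} \<union> R"
      using z by (auto simp: R_def)
  qed
  then have "top_defect a h \<le> measure lebesgue ({e * (e - 2 * k)<..<(e - k)\<^sup>2} \<union> R)"
    unfolding R_def top_defect_def e_def[symmetric] using *(5)
    by (intro measure_mono_fmeasurable fmeasurableD measure_Icc_gap_Un lmeasurable_Icc_Diff_sq) auto
  then have "top_defect a h \<le> k\<^sup>2 + measure lebesgue R"
    unfolding R_def using measure_Icc_gap_Un(2)[OF less_imp_le[OF *(5)]] *(7) by simp
  also have "measure lebesgue R = defect (e - k) k"
    by (simp add: defect_def R_def)
  also have "\<dots> \<le> k\<^sup>2 / 7"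
    using * by (intro defect_le) auto
  finally show ?thesis
    by (simp add: k_def power_divide)
qed

text \<open>The recursion of \<open>defect_le\<close>, now subtracting at most
  \<open>k^4 / 7\<close> for the overlap. A loss \<open>c * h^4\<close> must satisfy
  \<open>81 * c = 2 * c + 1 / 7\<close>, so \<open>c = 1 / 553\<close>.\<close>

lemma defect_ge:
  assumes "2 / 3 \<le> a" "a + h \<le> 1" "h = 1 / 3 ^ q"
  shows "h\<^sup>2 / 7 - h ^ 4 / 553 \<le> defect a h"
proof -
  \<comment> \<open>The last term makes the bound nonpositive at \<open>n = 0\<close>; two cylinders
    with a ninth of the squared length give the factor \<open>2 / 9\<close>.\<close>
  have approx: "h\<^sup>2 / 7 - h ^ 4 / 553 - h\<^sup>2 / 7 * (2 / 9) ^ n \<le> defect a h" for n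
    using assms
  proof (induction n arbitrary: a h q)
    case 0
    show ?case
      by (rule order.trans[OF _ defect_nonneg]) simp
  next
    case (Suc n)
    define k where "k = h / 3"
    have k: "h = 3 * k" "0 < k" "a + 3 * k \<le> 1" "k = 1 / 3 ^ Suc q"
      using Suc.prems(2,3) by (auto simp: k_def)
    define d where "d = k\<^sup>2 / 7 - k ^ 4 / 553 - k\<^sup>2 / 7 * (2 / 9) ^ n"
    have "d \<le> defect a k" "d \<le> defect (a + 2 * k) k" "top_defect a k \<le> k ^ 4 / 7"
      unfolding d_def using Suc.prems(1) k(2,3)
      by (intro Suc.IH[OF _ _ k(4)] top_defect_le[OF _ _ k(4)]; simp)+
    then have "2 * d + k\<^sup>2 - k ^ 4 / 7 \<le> defect a h"
      using defect_split[of a k] Suc.prems(1) k(1-3) by simp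
    moreover have "h\<^sup>2 / 7 - h ^ 4 / 553 - h\<^sup>2 / 7 * (2 / 9) ^ Suc n = 2 * d + k\<^sup>2 - k ^ 4 / 7"
      unfolding d_def k(1) by (simp add: power_mult_distrib field_simps)
    ultimately show ?case by simp
  qed
  have "(\<lambda>n. h\<^sup>2 / 7 - h ^ 4 / 553 - h\<^sup>2 / 7 * (2 / 9) ^ n) \<longlonglongrightarrow> h\<^sup>2 / 7 - h ^ 4 / 553 - h\<^sup>2 / 7 * 0"
    by (intro tendsto_intros LIMSEQ_realpow_zero) auto
  then show ?thesis
    using approx by (intro LIMSEQ_le_const2[of _ "h\<^sup>2 / 7 - h ^ 4 / 553"]) auto
qed

text \<open>\<open>k = h^2 / 3\<close> is again a power of \<open>1 / 3\<close>, so
  \<open>defect_ge\<close> applies to the defect in \<open>top_defect_ge_defect\<close>; here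
  \<open>44793 = 81 * 553\<close>.\<close>

lemma top_defect_ge:
  assumes "2 / 3 \<le> a" "a + h \<le> 1" "h = 1 / 3 ^ q"
  shows "8 / 63 * h ^ 4 - h ^ 8 / 44793 \<le> top_defect a h"
proof -
  define k where "k = h\<^sup>2 / 3"
  note * = sq_near_top[OF assms, folded k_def]
  have "k = 1 / 3 ^ Suc (2 * q)"
    by (simp add: k_def assms(3) power_divide power_mult[symmetric] mult.commute)
  then have "k\<^sup>2 / 7 - k ^ 4 / 553 \<le> defect (a + h - k) k"
    using *(1,3,4) by (intro defect_ge) linarith+
  then have "h ^ 4 / 9 + (k\<^sup>2 / 7 - k ^ 4 / 553) \<le> top_defect a h"
    using top_defect_ge_defect[OF assms, folded k_def] by linarith
  then show ?thesis
    by (simp add: k_def power_divide)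
qed

section \<open>From defects to the measure of the product set\<close>

lemma measure_sq_eq:
  assumes "0 \<le> a" "0 \<le> h"
  shows "measure lebesgue (sq a h) = (a + h)\<^sup>2 - a\<^sup>2 - defect a h"
proof -
  have "a\<^sup>2 \<le> (a + h)\<^sup>2"
    using assms by (intro power_mono) auto
  then have "measure lebesgue ({a\<^sup>2..(a + h)\<^sup>2} - sq a h) = (a + h)\<^sup>2 - a\<^sup>2 - measure lebesgue (sq a h)"
    using sq_subset_Icc[OF assms] lmeasurable_sq[of a h]
    by (subst measurable_measure_Diff) (auto simp: fmeasurableD)
  then show ?thesis by (simp add: defect_def)
qed

lemma measure_products:
  "measure lebesgue (mult_map ` (cantor_set \<times> cantor_set)) = 3 / 2 * measure lebesgue (sq (2 / 3) (1 / 3))"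
proof -
  define K where "K = cantor_set"
  define T where "T = prod_set K K"
  have T: "mult_map ` (cantor_set \<times> cantor_set) = T"
    by (simp add: T_def K_def mult_map_def prod_set_eq_image case_prod_unfold)
  have K: "K = cyl 0 (1 / 3) \<union> cyl (2 / 3) (1 / 3)"
    using cyl_split[of 0 "1 / 3"] by (simp add: K_def cyl_def)
  have third: "(*) (1 / 3) ` T = prod_set (cyl 0 (1 / 3)) K"
    unfolding T_def prod_set_scale[symmetric] cyl_def K_def by (simp only: add_0)
  have eq: "T = (*) (1 / 3) ` T \<union> sq (2 / 3) (1 / 3)"
    unfolding third unfolding T_def sq_def
    by (rule prod_set_Un_self[of "cyl 0 (1 / 3)" "cyl (2 / 3) (1 / 3)", folded K])
  \<comment> \<open>The two parts are disjoint because \<open>1 / 3 < 4 / 9\<close>.\<close>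
  have "prod_set (cyl 0 (1 / 3)) K \<subseteq> {0 * 0..(0 + 1 / 3) * 1}"
    unfolding K_def by (intro prod_set_subset_Icc cyl_subset_Icc cantor_set_subset_Icc) auto
  moreover have "sq (2 / 3) (1 / 3) \<subseteq> {4 / 9..}"
    using sq_subset_Icc[of "2 / 3" "1 / 3"] by (auto simp: power2_eq_square)
  ultimately have disj: "(*) (1 / 3) ` T \<inter> sq (2 / 3) (1 / 3) = {}"
    unfolding third by fastforce
  have "compact T"
    unfolding T_def K_def by (intro compact_prod_set compact_cantor_set)
  then have "(*) (1 / 3) ` T \<in> lmeasurable"
    by (intro lmeasurable_compact compact_continuous_image continuous_intros)
  then have "measure lebesgue T = measure lebesgue ((*) (1 / 3) ` T) + measure lebesgue (sq (2 / 3) (1 / 3))"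
    by (subst eq) (intro measure_fmeasurable_Un_disjoint lmeasurable_sq disj)
  moreover have "measure lebesgue ((*) (1 / 3) ` T) = 1 / 3 * measure lebesgue T"
    using measure_lebesgue_affine[of "1 / 3" 0 T] by simp
  ultimately show ?thesis unfolding T by simp
qed

theorem theorem1p1:
  shows "\<bar>measure lebesgue (mult_map ` (cantor_set \<times> cantor_set)) - 91782451 / 113374080\<bar>
           \<le> 1 / 10 ^ 6"
proof -
  \<comment> \<open>Two exact levels of splitting reduce the defect to four cylinders of length
    \<open>1 / 27\<close> and three overlaps.\<close>
  have split: "defect (2 / 3) (1 / 3) + top_defect (2 / 3) (1 / 9) =
      defect (2 / 3) (1 / 9) + defect (8 / 9) (1 / 9) + 1 / 81"
    "defect (2 / 3) (1 / 9) + top_defect (2 / 3) (1 / 27) =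
      defect (2 / 3) (1 / 27) + defect (20 / 27) (1 / 27) + 1 / 729"
    "defect (8 / 9) (1 / 9) + top_defect (8 / 9) (1 / 27) =
      defect (8 / 9) (1 / 27) + defect (26 / 27) (1 / 27) + 1 / 729"
    using defect_split[of "2 / 3" "1 / 9"] defect_split[of "2 / 3" "1 / 27"]
      defect_split[of "8 / 9" "1 / 27"]
    by (simp_all add: power2_eq_square)
  have h: "(1 / 9 :: real) = 1 / 3 ^ 2" "(1 / 27 :: real) = 1 / 3 ^ 3"
    by simp_all
  have pow: "(1 / 9 :: real) ^ 2 = 1 / 81" "(1 / 9 :: real) ^ 4 = 1 / 6561"
    "(1 / 9 :: real) ^ 8 = 1 / 43046721"
    "(1 / 27 :: real) ^ 2 = 1 / 729" "(1 / 27 :: real) ^ 4 = 1 / 531441"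
    "(1 / 27 :: real) ^ 8 = 1 / 282429536481"
    by (simp_all add: power_divide)
  have defect: "1 / 5103 - 1 / 293886873 \<le> defect a (1 / 27)" "defect a (1 / 27) \<le> 1 / 5103"
    if "2 / 3 \<le> a" "a \<le> 26 / 27" for a
    using defect_ge[OF that(1) _ h(2)] defect_le[OF that(1), of "1 / 27"] that(2) unfolding pow
    by simp_all
  \<comment> \<open>The dominant overlap gets the sharp bound, whose extra hypothesis reads
    \<open>3 + 1 / 81 <= 28 / 9\<close> here.\<close>
  have top: "8 / 413343 - 1 / 1928191773753 \<le> top_defect (2 / 3) (1 / 9)"
    "top_defect (2 / 3) (1 / 9) \<le> 8 / 413343"
    using top_defect_ge[OF _ _ h(1), of "2 / 3"] top_defect_le_sharp[OF _ _ h(1), of "2 / 3"]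
    unfolding pow by simp_all
  have top': "1 / 4782969 \<le> top_defect a (1 / 27)" "top_defect a (1 / 27) \<le> 1 / 3720087"
    if "2 / 3 \<le> a" "a \<le> 26 / 27" for a
    using top_defect_ge[OF that(1) _ h(2)] top_defect_le[OF that(1) _ h(2)] that(2)
    unfolding pow by simp_all
  have "measure lebesgue (mult_map ` (cantor_set \<times> cantor_set)) =
      3 / 2 * (5 / 9 - defect (2 / 3) (1 / 3))"
    unfolding measure_products by (simp add: measure_sq_eq power2_eq_square)
  moreover note split top top'[of "2 / 3", simplified] top'[of "8 / 9", simplified]
    defect[of "2 / 3", simplified] defect[of "20 / 27", simplified]
    defect[of "8 / 9", simplified] defect[of "26 / 27", simplified]
  ultimately show ?thesis
    unfolding abs_le_iff by (intro conjI; simp; linarith)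
qed

end
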